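(* Let $r\geq 2$ and suppose $C:\mathbb{Z}_r^n\to\mathbb{Z}_r^N$ is a $(q,c,\varepsilon)$-smooth code. Then for every $i\in[n]$ there exists a collection $M_i$ of at least $\varepsilon N/(2cq)$ pairwise disjoint subsets of $[N]$, each of size at most $q$, such that for every $Q\in M_i$ there is a function $f_Q:\mathbb{Z}_r^{|Q|}\to\mathbb{Z}_r$ with \[ \sum_{k=1}^{r-1}\mathbb{E}_{x\sim\mathbb{Z}_r^n}\Big[\omega_r^{k(f_Q(C(x)_Q)-x_i)}\Big]\geq\frac r2\varepsilon, \] where $x$ is uniform in $\mathbb{Z}_r^n$ and $C(x)_Q$ is the restriction of $C(x)$ to the coordinates in $Q$.
   Context: $\omega_r=e^{2\pi i/r}$. $C:\mathbb{Z}_r^n\to\mathbb{Z}_r^N$ is a $(q,c,\varepsilon)$-smooth code if there is a randomized decoding algorithm $\mathcal{A}$ such that for every $x\in\mathbb{Z}_r^n$ and $i\in[n]$, $\mathcal{A}$ makes at most $q$ non-adaptive queries to $C(x)$ and outputs $\mathcal{A}^{C(x)}(i)\in\mathbb{Z}_r$ with $\Pr[\mathcal{A}^{C(x)}(i)=x_i]\geq 1/r+\varepsilon$, and for every $x$, $i$ and $j\in[N]$, on input $i$ the probability that $\mathcal{A}$ queries coordinate $j$ is at most $c/N$ (probabilities over the randomness of $\mathcal{A}$). *)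

theory Defs
  imports "HOL-Probability.Probability" "HOL-Library.Complex_Order"
begin

text \<open>
  \<open>\<int>\<^sub>r\<close> is represented by its residues \<open>0, \<dots>, r - 1\<close>, coordinates are numbered from \<open>0\<close>
  (so \<open>[n]\<close> is \<^term>\<open>{..<n}\<close>), and a vector over \<open>\<int>\<^sub>r\<close> with coordinates in \<open>I\<close> is an extensional
  function on \<open>I\<close>.  The restriction \<open>y\<^sub>Q\<close> of a word \<open>y\<close> to the coordinates in \<open>Q\<close> is
  \<^term>\<open>restrict y Q\<close>, whose coordinates keep their names; \<open>\<int>\<^sub>r\<^bsup>|Q|\<^esup>\<close> is thus
  \<open>residue_vecs r Q\<close>.
\<close>

definition residues_mod :: "nat \<Rightarrow> int set" where
  "residues_mod r = {0..<int r}"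

definition residue_vecs :: "nat \<Rightarrow> nat set \<Rightarrow> (nat \<Rightarrow> int) set" where
  "residue_vecs r I = (I \<rightarrow>\<^sub>E residues_mod r)"

definition root_of_unity :: "nat \<Rightarrow> complex" where
  "root_of_unity r = exp (2 * of_real pi * \<i> / of_nat r)"

text \<open>
  On input \<open>i\<close>, a non-adaptive randomized decoder uses its random coins to fix a query set \<open>Q\<close> and
  a rule \<open>g\<close> that turns the answers into the output.  Coins used after reading the answers can be
  drawn in advance, so \<open>g\<close> is deterministic.  As there are only finitely many query sets and rules
  on \<open>\<int>\<^sub>r\<^bsup>|Q|\<^esup>\<close>, discrete distributions lose no generality.
\<close>

type_synonym decoder = "nat \<Rightarrow> (nat set \<times> ((nat \<Rightarrow> int) \<Rightarrow> int)) pmf"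

definition nonadaptive_decoder :: "nat \<Rightarrow> nat \<Rightarrow> nat \<Rightarrow> nat \<Rightarrow> decoder \<Rightarrow> bool" where
  "nonadaptive_decoder r n N q A \<longleftrightarrow>
     (\<forall>i<n. \<forall>(Q, g)\<in>set_pmf (A i).
        Q \<subseteq> {..<N} \<and> card Q \<le> q \<and> g \<in> residue_vecs r Q \<rightarrow> residues_mod r)"

definition decoder_output :: "decoder \<Rightarrow> (nat \<Rightarrow> int) \<Rightarrow> nat \<Rightarrow> int pmf" where
  "decoder_output A y i = map_pmf (\<lambda>(Q, g). g (restrict y Q)) (A i)"

definition decoder_queries :: "decoder \<Rightarrow> nat \<Rightarrow> nat set pmf" where
  "decoder_queries A i = map_pmf fst (A i)"

text \<open>
  The query distribution of a non-adaptive decoder does not depend on the word that is read, so the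
  smoothness condition (the last conjunct) has no quantifier over the message.
\<close>

definition smooth_code ::
  "nat \<Rightarrow> nat \<Rightarrow> nat \<Rightarrow> nat \<Rightarrow> real \<Rightarrow> real \<Rightarrow> ((nat \<Rightarrow> int) \<Rightarrow> nat \<Rightarrow> int) \<Rightarrow> bool" where
  "smooth_code r n N q c \<epsilon> C \<longleftrightarrow>
     C \<in> residue_vecs r {..<n} \<rightarrow> residue_vecs r {..<N} \<and>
     (\<exists>A. nonadaptive_decoder r n N q A \<and>
        (\<forall>x\<in>residue_vecs r {..<n}. \<forall>i<n.
           measure_pmf.prob (decoder_output A (C x) i) {x i} \<ge> 1 / real r + \<epsilon>) \<and>
        (\<forall>i<n. \<forall>j<N.
           measure_pmf.prob (decoder_queries A i) {Q. j \<in> Q} \<le> c / real N))"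

end

theory Submission
  imports Defs
begin

text \<open>
  Summing the nontrivial characters of \<open>\<int>\<^sub>r\<close> turns the claimed inequality into
  \<open>Pr\<^sub>x[f\<^sub>Q(C(x)\<^sub>Q) = x\<^sub>i] \<ge> 1/r + \<epsilon>/2\<close>; call \<open>Q\<close> good if some \<open>f\<^sub>Q\<close> achieves this.  Averaging the
  success probability of the decoder over a uniform message shows that it queries a good set with
  probability at least \<open>\<epsilon>/2\<close>.  Let \<open>M\<close> be a maximal disjoint family of good sets.  Good sets are
  nonempty, so each of them meets \<open>\<Union>M\<close>, which has at most \<open>q|M|\<close> elements; by smoothness this
  happens with probability at most \<open>q|M|c/N\<close>, whence \<open>|M| \<ge> \<epsilon>N/(2cq)\<close>.
\<close>

section \<open>Vectors over the residues modulo r\<close>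

lemma finite_residue_vecs: "finite I \<Longrightarrow> finite (residue_vecs r I)"
  unfolding residue_vecs_def residues_mod_def by (intro finite_PiE) auto

lemma residue_vecs_nonempty: "r > 0 \<Longrightarrow> residue_vecs r I \<noteq> {}"
  unfolding residue_vecs_def residues_mod_def by (auto simp: PiE_eq_empty_iff)

lemma restrict_in_residue_vecs:
  "y \<in> residue_vecs r I \<Longrightarrow> J \<subseteq> I \<Longrightarrow> restrict y J \<in> residue_vecs r J"
  unfolding residue_vecs_def by auto

lemma residue_vecs_coord: "y \<in> residue_vecs r I \<Longrightarrow> i \<in> I \<Longrightarrow> y i \<in> residues_mod r"
  unfolding residue_vecs_def by auto

section \<open>Character sums over the residues modulo r\<close>

lemma root_of_unity_powi: "root_of_unity r powi d = cis (2 * pi * of_int d / of_nat r)"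
proof -
  have "root_of_unity r = cis (2 * pi / of_nat r)"
    unfolding root_of_unity_def cis_conv_exp by (simp add: field_simps)
  then show ?thesis
    by (simp add: cis_power_int mult_ac)
qed

lemma root_of_unity_powi_eq_1_iff:
  assumes "r > 0"
  shows "root_of_unity r powi d = 1 \<longleftrightarrow> int r dvd d"
proof -
  have "root_of_unity r powi d = 1 \<longleftrightarrow> (\<exists>m. 2 * pi * of_int d / of_nat r = of_int m * (2 * pi))"
    unfolding root_of_unity_powi cis_conv_exp by (simp add: exp_eq_1 mult_ac)
  also have "\<dots> \<longleftrightarrow> (\<exists>m. (of_int d :: real) = of_int (int r * m))"
    using assms by (simp add: field_simps)
  also have "\<dots> \<longleftrightarrow> int r dvd d"
    unfolding of_int_eq_iff by (auto simp: dvd_def)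
  finally show ?thesis .
qed

text \<open>Adding the term k = 0 gives a geometric series in z =
  \<open>root_of_unity r powi d\<close>. It equals r if z = 1, and vanishes otherwise because z ^ r
  = 1. The subtracted 1 is the term k = 0.\<close>

lemma sum_nontrivial_characters:
  assumes "r > 0"
  shows "(\<Sum>k=1..r-1. root_of_unity r powi (int k * d)) = (if int r dvd d then of_nat r else 0) - 1"
proof -
  let ?z = "root_of_unity r powi d"
  have powi: "root_of_unity r powi (int k * d) = ?z ^ k" for k
    by (metis mult.commute power_int_mult power_int_of_nat)
  have geometric: "(\<Sum>k<r. ?z ^ k) = (if int r dvd d then of_nat r else 0)"
  proof (cases "int r dvd d")
    case True
    then have "?z = 1"
      using assms root_of_unity_powi_eq_1_iff by blast
    then show ?thesis
      using True by simp
  next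
    case False
    then have "?z \<noteq> 1"
      using assms root_of_unity_powi_eq_1_iff by blast
    moreover have "?z ^ r = 1"
      using root_of_unity_powi_eq_1_iff[OF assms, of "int r * d"] powi by simp
    ultimately show ?thesis
      using False by (simp add: geometric_sum)
  qed
  have "{..<r} = insert 0 {1..r-1}"
    using assms by auto
  then have "(\<Sum>k=1..r-1. root_of_unity r powi (int k * d)) = (\<Sum>k<r. ?z ^ k) - 1"
    unfolding powi by simp
  then show ?thesis
    unfolding geometric .
qed

text \<open>Two numbers in \<open>{0..<int r}\<close> are congruent modulo r only if they are equal.
  Pointwise the character sum is therefore r times the indicator of u = v, minus 1, and linearity of
  expectation finishes. This is the bridge between the exponential sum and a success
  probability.\<close>

lemma expectation_nontrivial_characters:
  fixes p :: "'a pmf"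
  assumes "finite (set_pmf p)" "r > 0"
    and "\<And>x. x \<in> set_pmf p \<Longrightarrow> u x \<in> residues_mod r"
    and "\<And>x. x \<in> set_pmf p \<Longrightarrow> v x \<in> residues_mod r"
  shows "(\<Sum>k=1..r-1. measure_pmf.expectation p (\<lambda>x. root_of_unity r powi (int k * (u x - v x))))
    = complex_of_real (real r * measure_pmf.prob p {x. u x = v x} - 1)"
proof -
  have dvd: "int r dvd u x - v x \<longleftrightarrow> u x = v x" if "x \<in> set_pmf p" for x
  proof -
    have "u x mod int r = u x" "v x mod int r = v x"
      using assms(3,4)[OF that] by (auto simp: residues_mod_def)
    then show ?thesis
      using mod_eq_dvd_iff[of "u x" "int r" "v x"] by simp
  qed
  have characters: "(\<Sum>k=1..r-1. root_of_unity r powi (int k * (u x - v x)))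
      = complex_of_real (real r * indicator {x. u x = v x} x - 1)" if "x \<in> set_pmf p" for x
    unfolding sum_nontrivial_characters[OF \<open>r > 0\<close>] dvd[OF that] by simp
  have "(\<Sum>k=1..r-1. measure_pmf.expectation p (\<lambda>x. root_of_unity r powi (int k * (u x - v x))))
    = measure_pmf.expectation p (\<lambda>x. \<Sum>k=1..r-1. root_of_unity r powi (int k * (u x - v x)))"
    by (intro Bochner_Integration.integral_sum[symmetric] integrable_measure_pmf_finite assms)
  also have "\<dots> = measure_pmf.expectation p
      (\<lambda>x. complex_of_real (real r * indicator {x. u x = v x} x - 1))"
    by (intro integral_cong_AE AE_pmfI characters) simp_all
  also have "\<dots> = complex_of_real
      (measure_pmf.expectation p (\<lambda>x. real r * indicator {x. u x = v x} x - 1))"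
    by (rule integral_complex_of_real)
  also have "measure_pmf.expectation p (\<lambda>x. real r * indicator {x. u x = v x} x - 1)
      = real r * measure_pmf.prob p {x. u x = v x} - 1"
    by (subst Bochner_Integration.integral_diff)
       (auto intro!: integrable_measure_pmf_finite assms)
  finally show ?thesis .
qed

section \<open>Uniform messages and averaging\<close>

lemma prob_residue_vecs_coord:
  assumes "i \<in> I" "finite I" "a \<in> residues_mod r"
  shows "measure_pmf.prob (pmf_of_set (residue_vecs r I)) {x. x i = a} = 1 / real r"
proof -
  let ?X = "residue_vecs r I"
  have r: "r > 0"
    using assms by (auto simp: residues_mod_def)
  have card_res: "card (residues_mod r) = r"
    by (simp add: residues_mod_def)
  \<comment> \<open>Written as a product with the singleton factor \<open>{a}\<close> at i, the
    event can be counted by \<open>card_PiE\<close>: the other \<open>card I - 1\<close> coordinates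
    stay free.\<close>
  have "?X \<inter> {x. x i = a} = (\<Pi>\<^sub>E j\<in>I. if j = i then {a} else residues_mod r)"
  proof (intro set_eqI iffI)
    fix x assume "x \<in> ?X \<inter> {x. x i = a}"
    then show "x \<in> (\<Pi>\<^sub>E j\<in>I. if j = i then {a} else residues_mod r)"
      by (auto simp: residue_vecs_def PiE_iff)
  next
    fix x assume x: "x \<in> (\<Pi>\<^sub>E j\<in>I. if j = i then {a} else residues_mod r)"
    have "x i = a"
      using PiE_mem[OF x \<open>i \<in> I\<close>] by simp
    moreover have "x j \<in> residues_mod r" if "j \<in> I" for j
      using PiE_mem[OF x that] assms(3) by (simp split: if_splits)
    ultimately show "x \<in> ?X \<inter> {x. x i = a}"
      using x by (simp add: residue_vecs_def PiE_iff)
  qed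
  then have "card (?X \<inter> {x. x i = a}) = (\<Prod>j\<in>I. if j = i then 1 else r)"
    using assms by (simp add: card_PiE card_res if_distrib cong: if_cong)
  also have "\<dots> = r ^ (card I - 1)"
    using assms by (simp add: prod.remove)
  finally have "card (?X \<inter> {x. x i = a}) = r ^ (card I - 1)" .
  moreover have "card ?X = r * r ^ (card I - 1)"
  proof -
    have "card I > 0"
      using assms by (auto simp: card_gt_0_iff)
    then have "r ^ card I = r * r ^ (card I - 1)"
      by (simp add: power_eq_if)
    then show ?thesis
      using assms(2) by (simp add: residue_vecs_def card_PiE card_res)
  qed
  ultimately show ?thesis
    using r assms residue_vecs_nonempty[of r I]
    by (simp add: measure_pmf_of_set finite_residue_vecs)
qed

text \<open>A reverse Markov inequality: X is below s off the event and at most 1 on it, so its mean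
  is at most s plus the probability of the event.\<close>

lemma prob_large_ge:
  fixes X :: "'a \<Rightarrow> real"
  assumes "\<And>a. 0 \<le> X a" "\<And>a. X a \<le> 1" "0 \<le> s" "s + \<delta> \<le> measure_pmf.expectation p X"
  shows "\<delta> \<le> measure_pmf.prob p {a. s \<le> X a}"
proof -
  have int: "integrable p (\<lambda>a. indicat_real {a. s \<le> X a} a)"
    by (rule measure_pmf.integrable_const_bound[of _ 1]) auto
  have "measure_pmf.expectation p X
      \<le> measure_pmf.expectation p (\<lambda>a. s + indicator {a. s \<le> X a} a)"
  proof (rule integral_mono)
    show "integrable p X"
      using assms by (intro measure_pmf.integrable_const_bound[of _ 1]) auto
    show "X a \<le> s + indicator {a. s \<le> X a} a" for a
      using assms(2)[of a] assms(3) by (auto simp: indicator_def)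
  qed (use int in auto)
  also have "\<dots> = s + measure_pmf.prob p {a. s \<le> X a}"
    by (subst Bochner_Integration.integral_add) (use int in auto)
  finally show ?thesis
    using assms by linarith
qed

text \<open>Fubini for an event, where the finite support of p turns one integral into a finite sum.
  It converts the decoder's success on each message, averaged over messages, into the success of
  each pair of query set and rule, averaged over the coins.\<close>

lemma expectation_prob_commute:
  assumes "finite (set_pmf p)"
  shows "measure_pmf.expectation p (\<lambda>x. measure_pmf.prob p' {a. P x a})
    = measure_pmf.expectation p' (\<lambda>a. measure_pmf.prob p {x. P x a})"
proof -
  have "measure_pmf.expectation p (\<lambda>x. measure_pmf.prob p' {a. P x a})
    = (\<Sum>x\<in>set_pmf p. pmf p x * measure_pmf.expectation p' (indicator {a. P x a}))"
    by (subst integral_measure_pmf[OF assms]) auto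
  also have "\<dots> = (\<Sum>x\<in>set_pmf p.
      measure_pmf.expectation p' (\<lambda>a. pmf p x * indicator {a. P x a} a))"
    by simp
  also have "\<dots> = measure_pmf.expectation p'
      (\<lambda>a. \<Sum>x\<in>set_pmf p. pmf p x * indicator {a. P x a} a)"
    by (intro Bochner_Integration.integral_sum[symmetric] integrable_mult_right
        measure_pmf.integrable_const_bound[of _ 1]) auto
  also have "\<dots> = measure_pmf.expectation p' (\<lambda>a. measure_pmf.expectation p (indicator {x. P x a}))"
    by (subst integral_measure_pmf[OF assms]) (auto simp: indicator_def)
  finally show ?thesis
    by simp
qed

section \<open>Maximal disjoint families of query sets\<close>

lemma exists_maximal_disjoint:
  assumes "finite F"
  obtains M where "M \<subseteq> F" "disjoint M" "\<And>Q. Q \<in> F \<Longrightarrow> Q \<noteq> {} \<Longrightarrow> Q \<inter> \<Union>M \<noteq> {}"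
proof -
  let ?D = "{M. M \<subseteq> F \<and> disjoint M}"
  have "finite ?D" "{} \<in> ?D"
    using assms by (auto intro: finite_subset[of _ "Pow F"])
  from finite_has_maximal2[OF this]
  obtain M where M: "M \<in> ?D" and max: "\<forall>M'\<in>?D. M \<subseteq> M' \<longrightarrow> M = M'"
    by (elim bexE conjE)
  have "Q \<inter> \<Union>M \<noteq> {}" if Q: "Q \<in> F" "Q \<noteq> {}" for Q
  proof
    \<comment> \<open>Such a Q could be added to M, so maximality puts it in M already. Then Q is
      contained in \<open>\<Union>M\<close>, and being nonempty it meets that union.\<close>
    assume disj: "Q \<inter> \<Union>M = {}"
    then have "insert Q M \<in> ?D"
      using M Q by (auto simp: disjoint_def)
    then have "Q \<in> M"
      using max by blast
    then show False
      using disj Q by blast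
  qed
  then show thesis
    using M that by blast
qed

lemma prob_meets_le:
  fixes p :: "'a set pmf"
  assumes "finite V" "\<And>j. j \<in> V \<Longrightarrow> measure_pmf.prob p {Q. j \<in> Q} \<le> b"
  shows "measure_pmf.prob p {Q. Q \<inter> V \<noteq> {}} \<le> real (card V) * b"
proof -
  have "{Q. Q \<inter> V \<noteq> {}} = (\<Union>j\<in>V. {Q. j \<in> Q})"
    by auto
  then have "measure_pmf.prob p {Q. Q \<inter> V \<noteq> {}} \<le> (\<Sum>j\<in>V. measure_pmf.prob p {Q. j \<in> Q})"
    using assms by (simp add: measure_pmf.finite_measure_subadditive_finite)
  also have "\<dots> \<le> real (card V) * b"
    using assms by (intro sum_bounded_above) auto
  finally show ?thesis .
qed

text \<open>A random query set lies in F, and hence meets \<open>\<Union>M\<close>, with probability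
  at least \<delta>. A union bound over the at most \<open>card M * q\<close> points of
  \<open>\<Union>M\<close> limits this probability from above. The exclusion of \<open>{}\<close>
  matters, since the empty set meets nothing.\<close>

lemma card_disjoint_family_ge:
  assumes F: "F \<subseteq> Pow {..<N}" "{} \<notin> F" "\<And>Q. Q \<in> F \<Longrightarrow> card Q \<le> q"
    and smooth: "\<And>j. j < N \<Longrightarrow> measure_pmf.prob p {Q. j \<in> Q} \<le> c / real N"
    and prob: "\<delta> \<le> measure_pmf.prob p F"
    and pos: "c > 0" "q > 0"
  obtains M where "M \<subseteq> F" "disjoint M" "\<delta> * real N / (c * real q) \<le> real (card M)"
proof -
  have "finite F"
    using F(1) by (rule finite_subset) simp
  then obtain M where M: "M \<subseteq> F" "disjoint M" "\<And>Q. Q \<in> F \<Longrightarrow> Q \<noteq> {} \<Longrightarrow> Q \<inter> \<Union>M \<noteq> {}"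
    by (rule exists_maximal_disjoint) blast
  have V: "\<Union>M \<subseteq> {..<N}"
    using M F by blast
  have "card (\<Union>M) \<le> (\<Sum>Q\<in>M. card Q)"
    by (rule card_Union_le_sum_card)
  also have "\<dots> \<le> card M * q"
    using sum_bounded_above[of M card q] M F by auto
  finally have card_V: "real (card (\<Union>M)) \<le> real (card M) * real q"
    by (metis of_nat_le_iff of_nat_mult)
  have "\<delta> \<le> measure_pmf.prob p {Q. Q \<inter> \<Union>M \<noteq> {}}"
    using M(3) F(2)
    by (intro order_trans[OF prob] measure_pmf.finite_measure_mono) auto
  also have "\<dots> \<le> real (card (\<Union>M)) * (c / real N)"
    using V by (intro prob_meets_le smooth) (auto intro: finite_subset)
  also have "\<dots> \<le> real (card M) * real q * (c / real N)"
    using card_V pos by (intro mult_right_mono) auto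
  \<comment> \<open>For N = 0 the left-hand side is 0; otherwise the chain is solved for
    \<open>card M\<close>.\<close>
  finally have "\<delta> * real N / (c * real q) \<le> real (card M)"
    using pos by (cases "N = 0") (auto simp: field_simps)
  then show thesis
    using M that by blast
qed

section \<open>Good query sets of a smooth decoder\<close>

theorem theorem5p4:
  fixes r n N q :: nat and c \<epsilon> :: real
    and C :: "(nat \<Rightarrow> int) \<Rightarrow> nat \<Rightarrow> int"
  assumes "r \<ge> 2"
    and "smooth_code r n N q c \<epsilon> C"
  shows "\<forall>i<n. \<exists>M :: nat set set.
      real (card M) \<ge> \<epsilon> * real N / (2 * c * real q) \<and>
      disjoint M \<and>
      (\<forall>Q\<in>M. Q \<subseteq> {..<N} \<and> card Q \<le> q) \<and>
      (\<forall>Q\<in>M. \<exists>f \<in> residue_vecs r Q \<rightarrow> residues_mod r.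
         (\<Sum>k=1..r-1. measure_pmf.expectation (pmf_of_set (residue_vecs r {..<n}))
            (\<lambda>x. root_of_unity r powi (int k * (f (restrict (C x) Q) - x i))))
         \<ge> complex_of_real (real r / 2 * \<epsilon>))"
proof (intro allI impI)
  fix i assume i: "i < n"
  let ?X = "residue_vecs r {..<n}"
  let ?U = "pmf_of_set ?X"
  define success where
    "success Q f = measure_pmf.prob ?U {x. f (restrict (C x) Q) = x i}" for Q f
  \<comment> \<open>The advantage \<epsilon> is halved: one half stays in the threshold and gives
    r\<epsilon>/2 after multiplying by r and subtracting 1, the other half becomes the probability
    of querying a good set.\<close>
  define good where
    "good = {Q. Q \<subseteq> {..<N} \<and> card Q \<le> q \<and>
       (\<exists>f \<in> residue_vecs r Q \<rightarrow> residues_mod r. 1 / real r + \<epsilon> / 2 \<le> success Q f)}"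
  have r: "r > 0"
    using assms(1) by simp
  have X: "finite ?X" "?X \<noteq> {}"
    using r by (auto simp: finite_residue_vecs residue_vecs_nonempty)
  obtain A where C: "C \<in> ?X \<rightarrow> residue_vecs r {..<N}"
    and A: "nonadaptive_decoder r n N q A"
    and correct: "\<And>x. x \<in> ?X \<Longrightarrow>
      1 / real r + \<epsilon> \<le> measure_pmf.prob (decoder_output A (C x) i) {x i}"
    and smooth: "\<And>j. j < N \<Longrightarrow> measure_pmf.prob (decoder_queries A i) {Q. j \<in> Q} \<le> c / real N"
    using assms(2) i unfolding smooth_code_def by blast
  have characters: "complex_of_real (real r / 2 * \<epsilon>) \<le>
      (\<Sum>k=1..r-1. measure_pmf.expectation ?U
        (\<lambda>x. root_of_unity r powi (int k * (f (restrict (C x) Q) - x i))))"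
    if f: "f \<in> residue_vecs r Q \<rightarrow> residues_mod r" and Q: "Q \<subseteq> {..<N}"
      and succ: "1 / real r + \<epsilon> / 2 \<le> success Q f" for Q f
  proof -
    have "f (restrict (C x) Q) \<in> residues_mod r" "x i \<in> residues_mod r" if "x \<in> ?X" for x
      using that i f C Q
      by (auto intro!: residue_vecs_coord[of x r "{..<n}"] funcset_mem[OF f]
          restrict_in_residue_vecs[of _ r "{..<N}"])
    then have sum_eq: "(\<Sum>k=1..r-1. measure_pmf.expectation ?U
        (\<lambda>x. root_of_unity r powi (int k * (f (restrict (C x) Q) - x i))))
      = complex_of_real (real r * success Q f - 1)"
      unfolding success_def using X r by (intro expectation_nontrivial_characters) auto
    have "real r * (1 / real r + \<epsilon> / 2) = 1 + real r / 2 * \<epsilon>"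
      using r by (simp add: field_simps)
    then have "real r / 2 * \<epsilon> \<le> real r * success Q f - 1"
      using mult_left_mono[OF succ, of "real r"] by simp
    then show ?thesis
      \<comment> \<open>The complex order also demands equal imaginary parts; both sides are
        embedded reals.\<close>
      unfolding sum_eq by (simp add: less_eq_complex_def)
  qed
  show "\<exists>M :: nat set set.
      real (card M) \<ge> \<epsilon> * real N / (2 * c * real q) \<and>
      disjoint M \<and>
      (\<forall>Q\<in>M. Q \<subseteq> {..<N} \<and> card Q \<le> q) \<and>
      (\<forall>Q\<in>M. \<exists>f \<in> residue_vecs r Q \<rightarrow> residues_mod r.
         (\<Sum>k=1..r-1. measure_pmf.expectation ?U
            (\<lambda>x. root_of_unity r powi (int k * (f (restrict (C x) Q) - x i))))
         \<ge> complex_of_real (real r / 2 * \<epsilon>))"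
  \<comment> \<open>In the degenerate cases the required size is at most 0, so the empty family
    serves.\<close>
  proof (cases "\<epsilon> > 0 \<and> c > 0 \<and> N > 0 \<and> q > 0")
    case False
    \<comment> \<open>The probability of querying coordinate 0 is nonnegative and at most
      c/N.\<close>
    have c: "0 \<le> c" if "N > 0"
    proof -
      have "0 \<le> c / real N"
        using order_trans[OF measure_nonneg smooth[OF that]] .
      then show ?thesis
        using that by (simp add: zero_le_divide_iff)
    qed
    have "\<epsilon> * real N / (2 * c * real q) \<le> 0"
    \<comment> \<open>If c, N or q is 0, the quotient is 0, by division by zero when c or q is.
      Otherwise c is positive, so the failing condition must be the one on \<epsilon>.\<close>
    proof (cases "c = 0 \<or> N = 0 \<or> q = 0")
      case False
      then have "0 \<le> c" "\<epsilon> \<le> 0"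
        using c \<open>\<not> (\<epsilon> > 0 \<and> c > 0 \<and> N > 0 \<and> q > 0)\<close> by auto
      then show ?thesis
        by (intro divide_nonpos_nonneg mult_nonpos_nonneg) auto
    qed auto
    then show ?thesis
      by (intro exI[of _ "{}"]) auto
  next
    case True
    \<comment> \<open>With no queries the output is a constant, the value of f at the only vector
      without coordinates, \<open>\<lambda>_. undefined\<close>. It equals the uniform
      \<open>x i\<close> with probability exactly 1/r, below the threshold.\<close>
    have empty_bad: "{} \<notin> good"
    proof
      assume "{} \<in> good"
      then obtain f where f: "f \<in> residue_vecs r {} \<rightarrow> residues_mod r"
        and succ: "1 / real r + \<epsilon> / 2 \<le> success {} f"
        unfolding good_def by blast
      have "f (\<lambda>_. undefined) \<in> residues_mod r"
        using f by (auto simp: residue_vecs_def)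
      then have "measure_pmf.prob ?U {x. x i = f (\<lambda>_. undefined)} = 1 / real r"
        using i by (intro prob_residue_vecs_coord) auto
      then have "success {} f = 1 / real r"
        unfolding success_def by (simp add: restrict_def eq_commute)
      then show False
        using succ True by simp
    qed
    \<comment> \<open>The sum is split to fit \<open>prob_large_ge\<close> with s = 1/r +
      \<epsilon>/2 and \<delta> = \<epsilon>/2.\<close>
    have "1 / real r + \<epsilon> / 2 + \<epsilon> / 2
        \<le> measure_pmf.expectation ?U (\<lambda>x. measure_pmf.prob (A i) {(Q, g). g (restrict (C x) Q) = x i})"
    proof (rule measure_pmf.integral_ge_const)
      show "AE x in ?U. 1 / real r + \<epsilon> / 2 + \<epsilon> / 2
          \<le> measure_pmf.prob (A i) {(Q, g). g (restrict (C x) Q) = x i}"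
      proof (rule AE_pmfI)
        fix x assume "x \<in> set_pmf ?U"
        then show "1 / real r + \<epsilon> / 2 + \<epsilon> / 2
            \<le> measure_pmf.prob (A i) {(Q, g). g (restrict (C x) Q) = x i}"
          using correct[of x] X by (simp add: decoder_output_def vimage_def case_prod_unfold)
      qed
      show "integrable ?U (\<lambda>x. measure_pmf.prob (A i) {(Q, g). g (restrict (C x) Q) = x i})"
        using X by (intro integrable_measure_pmf_finite) simp
    qed
    also have "\<dots> = measure_pmf.expectation (A i) (\<lambda>(Q, g). success Q g)"
      using X expectation_prob_commute[of ?U "A i" "\<lambda>x (Q, g). g (restrict (C x) Q) = x i"]
      by (simp add: success_def case_prod_unfold)
    finally have "\<epsilon> / 2 \<le> measure_pmf.prob (A i)
        {a. 1 / real r + \<epsilon> / 2 \<le> (case a of (Q, g) \<Rightarrow> success Q g)}"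
      using True by (intro prob_large_ge) (auto simp: success_def split: prod.split)
    \<comment> \<open>If the pair (Q, g) drawn by the decoder reaches the threshold, its own rule g
      witnesses that Q is good.\<close>
    also have "\<dots> \<le> measure_pmf.prob (A i) (fst -` good)"
    proof (rule measure_pmf.finite_measure_mono_AE)
      show "AE a in A i. a \<in> {a. 1 / real r + \<epsilon> / 2 \<le> (case a of (Q, g) \<Rightarrow> success Q g)}
          \<longrightarrow> a \<in> fst -` good"
      proof (rule AE_pmfI)
        fix a assume "a \<in> set_pmf (A i)"
        then have "fst a \<subseteq> {..<N}" "card (fst a) \<le> q"
          "snd a \<in> residue_vecs r (fst a) \<rightarrow> residues_mod r"
          using A i unfolding nonadaptive_decoder_def case_prod_unfold by blast+
        then show "a \<in> {a. 1 / real r + \<epsilon> / 2 \<le> (case a of (Q, g) \<Rightarrow> success Q g)}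
            \<longrightarrow> a \<in> fst -` good"
          unfolding good_def case_prod_unfold by blast
      qed
    qed simp
    also have "\<dots> = measure_pmf.prob (decoder_queries A i) good"
      by (simp add: decoder_queries_def)
    finally have prob_good: "\<epsilon> / 2 \<le> measure_pmf.prob (decoder_queries A i) good" .
    have "good \<subseteq> Pow {..<N}" "\<And>Q. Q \<in> good \<Longrightarrow> card Q \<le> q"
      by (auto simp: good_def)
    then obtain M where M: "M \<subseteq> good" "disjoint M"
      and card_M: "\<epsilon> / 2 * real N / (c * real q) \<le> real (card M)"
      by (rule card_disjoint_family_ge[OF _ empty_bad _ smooth prob_good]) (use True in auto)
    show ?thesis
    proof (intro exI[of _ M] conjI ballI)
      show "\<epsilon> * real N / (2 * c * real q) \<le> real (card M)"
        using card_M by (simp add: mult.assoc)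
      show "disjoint M"
        by (fact M)
    next
      fix Q assume "Q \<in> M"
      then have Q: "Q \<in> good"
        using M by blast
      then show "Q \<subseteq> {..<N}" "card Q \<le> q"
        by (auto simp: good_def)
      obtain f where "f \<in> residue_vecs r Q \<rightarrow> residues_mod r" "1 / real r + \<epsilon> / 2 \<le> success Q f"
        using Q unfolding good_def by blast
      then show "\<exists>f \<in> residue_vecs r Q \<rightarrow> residues_mod r.
          (\<Sum>k=1..r-1. measure_pmf.expectation ?U
            (\<lambda>x. root_of_unity r powi (int k * (f (restrict (C x) Q) - x i))))
          \<ge> complex_of_real (real r / 2 * \<epsilon>)"
        using characters \<open>Q \<subseteq> {..<N}\<close> by (intro bexI[of _ f]) auto
    qed
  qed
qed

end
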